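(* Let $x_0=x_1\in\mathbb{R}^n$ and let $\{x_k\}_{k\ge0}$ be the iterates of mSGD/mSN/mSPP. Let $y_0=y_1=0\in\mathbb{R}^m$ and let $\{y_k\}_{k\ge0}$ be the iterates of mSDSA (stochastic dual subspace ascent with momentum). Assume that the methods use the same stepsize $\omega>0$, the same momentum parameter $\beta\ge0$, and the same sequence of random matrices $\mathbf{S}_k$. Then $$x_k=\phi(y_k)=x_0+\mathbf{B}^{-1}\mathbf{A}^\top y_k\qquad\text{for all }k\ge 0.$$
   Context: Let $\mathbf{A}\in\mathbb{R}^{m\times n}$ and $b\in\mathbb{R}^m$ be such that the linear system $\mathbf{A}x=b$ is consistent. Let $\mathbf{B}\in\mathbb{R}^{n\times n}$ be symmetric positive definite. Let $\mathcal{D}$ be an arbitrary probability distribution over real matrices $\mathbf{S}$ with $m$ rows. For such $\mathbf{S}$ define $$\mathbf{H}:=\mathbf{S}(\mathbf{S}^\top\mathbf{A}\mathbf{B}^{-1}\mathbf{A}^\top\mathbf{S})^\dagger\mathbf{S}^\top,\quad f_{\mathbf{S}}(x):=\tfrac12(\mathbf{A}x-b)^\top\mathbf{H}(\mathbf{A}x-b),$$ where $\dagger$ is the Moore–Penrose pseudoinverse. Gradients are with respect to the inner product $\langle x,z\rangle_{\mathbf{B}}:=x^\top\mathbf{B}z$, so $\nabla f_{\mathbf{S}}(x)=\mathbf{B}^{-1}\mathbf{A}^\top\mathbf{H}(\mathbf{A}x-b)$. Define $\phi:\mathbb{R}^m\to\mathbb{R}^n$ by $\phi(y):=x_0+\mathbf{B}^{-1}\mathbf{A}^\top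 y$. mSGD/mSN/mSPP (one and the same iteration): for each $k\ge 1$ draw a fresh $\mathbf{S}_k\sim\mathcal{D}$ and set $$x_{k+1}=x_k-\omega\nabla f_{\mathbf{S}_k}(x_k)+\beta(x_k-x_{k-1}).$$ mSDSA: for each $k\ge1$ draw a fresh $\mathbf{S}_k\sim\mathcal{D}$ and set $$\lambda_k=(\mathbf{S}_k^\top\mathbf{A}\mathbf{B}^{-1}\mathbf{A}^\top\mathbf{S}_k)^\dagger\mathbf{S}_k^\top\left(b-\mathbf{A}(x_0+\mathbf{B}^{-1}\mathbf{A}^\top y_k)\right),\qquad y_{k+1}=y_k+\omega\mathbf{S}_k\lambda_k+\beta(y_k-y_{k-1}).$$ *)

theory Defs
  imports
    "HOL-Probability.Probability"
    "Jordan_Normal_Form.Gauss_Jordan_Elimination"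
begin

no_notation inner (infix "\<bullet>" 70)
notation scalar_prod (infix "\<bullet>" 70)

definition sym_pos_def :: "nat \<Rightarrow> real mat \<Rightarrow> bool" where
  "sym_pos_def n B \<longleftrightarrow>
     B \<in> carrier_mat n n \<and> transpose_mat B = B \<and>
     (\<forall>v\<in>carrier_vec n. v \<noteq> 0\<^sub>v n \<longrightarrow> v \<bullet> (B *\<^sub>v v) > 0)"

(* mat_inverse is option-valued; it yields Some exactly for invertible square matrices *)
definition inv_mat :: "real mat \<Rightarrow> real mat" where
  "inv_mat B = the (mat_inverse B)"

(* The four Penrose conditions; over the reals, symmetry replaces Hermitian symmetry. *)
definition is_pinv :: "real mat \<Rightarrow> real mat \<Rightarrow> bool" where
  "is_pinv M P \<longleftrightarrow>
     P \<in> carrier_mat (dim_col M) (dim_row M) \<and>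
     M * P * M = M \<and> P * M * P = P \<and>
     transpose_mat (M * P) = M * P \<and> transpose_mat (P * M) = P * M"

definition pinv :: "real mat \<Rightarrow> real mat" where
  "pinv M = (THE P. is_pinv M P)"

definition inner_B :: "real mat \<Rightarrow> real vec \<Rightarrow> real vec \<Rightarrow> real" where
  "inner_B B x z = x \<bullet> (B *\<^sub>v z)"

definition norm_B :: "real mat \<Rightarrow> real vec \<Rightarrow> real" where
  "norm_B B x = sqrt (inner_B B x x)"

(* Frechet differentiability at x in the inner product space (R^n, inner_B B), with the
   derivative represented by g; n is the order of B. It is spelled out because the type
   of vectors of arbitrary length is not a normed space. *)
definition has_grad_B :: "real mat \<Rightarrow> (real vec \<Rightarrow> real) \<Rightarrow> real vec \<Rightarrow> real vec \<Rightarrow> bool" where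
  "has_grad_B B f g x \<longleftrightarrow>
     g \<in> carrier_vec (dim_row B) \<and>
     (\<forall>e>0. \<exists>d>0. \<forall>h\<in>carrier_vec (dim_row B). norm_B B h < d \<longrightarrow>
        \<bar>f (x + h) - f x - inner_B B g h\<bar> \<le> e * norm_B B h)"

definition grad_B :: "real mat \<Rightarrow> (real vec \<Rightarrow> real) \<Rightarrow> real vec \<Rightarrow> real vec" where
  "grad_B B f x = (THE g. has_grad_B B f g x)"

definition sketch_pinv :: "real mat \<Rightarrow> real mat \<Rightarrow> real mat \<Rightarrow> real mat" where
  "sketch_pinv A B S = pinv (transpose_mat S * A * inv_mat B * transpose_mat A * S)"

definition H_mat :: "real mat \<Rightarrow> real mat \<Rightarrow> real mat \<Rightarrow> real mat" where
  "H_mat A B S = S * sketch_pinv A B S * transpose_mat S"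

definition f_S :: "real mat \<Rightarrow> real mat \<Rightarrow> real vec \<Rightarrow> real mat \<Rightarrow> real vec \<Rightarrow> real" where
  "f_S A B b S x = 1 / 2 * ((A *\<^sub>v x - b) \<bullet> (H_mat A B S *\<^sub>v (A *\<^sub>v x - b)))"

definition phi :: "real mat \<Rightarrow> real mat \<Rightarrow> real vec \<Rightarrow> real vec \<Rightarrow> real vec" where
  "phi A B x0 y = x0 + (inv_mat B * transpose_mat A) *\<^sub>v y"

definition mSDSA_lambda ::
    "real mat \<Rightarrow> real mat \<Rightarrow> real vec \<Rightarrow> real vec \<Rightarrow> real mat \<Rightarrow> real vec \<Rightarrow> real vec" where
  "mSDSA_lambda A B b x0 S y =
     (sketch_pinv A B S * transpose_mat S) *\<^sub>v
       (b - A *\<^sub>v (x0 + (inv_mat B * transpose_mat A) *\<^sub>v y))"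

definition mSGD_step ::
    "real mat \<Rightarrow> real mat \<Rightarrow> real vec \<Rightarrow> real \<Rightarrow> real \<Rightarrow> real mat \<Rightarrow> real vec \<Rightarrow> real vec \<Rightarrow> real vec" where
  "mSGD_step A B b \<omega> \<beta> S x_cur x_prev =
     x_cur - \<omega> \<cdot>\<^sub>v grad_B B (f_S A B b S) x_cur + \<beta> \<cdot>\<^sub>v (x_cur - x_prev)"

definition mSDSA_step ::
    "real mat \<Rightarrow> real mat \<Rightarrow> real vec \<Rightarrow> real vec \<Rightarrow> real \<Rightarrow> real \<Rightarrow>
     real mat \<Rightarrow> real vec \<Rightarrow> real vec \<Rightarrow> real vec" where
  "mSDSA_step A B b x0 \<omega> \<beta> S y_cur y_prev =
     y_cur + \<omega> \<cdot>\<^sub>v (S *\<^sub>v mSDSA_lambda A B b x0 S y_cur) + \<beta> \<cdot>\<^sub>v (y_cur - y_prev)"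

(* D is a probability distribution, on an arbitrary sigma-algebra, over matrices with m
   rows and any number of columns, which may differ between samples; S 1, S 2, ... are
   independent samples from D, defined on the probability space M. *)
definition iid_sketches ::
    "nat \<Rightarrow> real mat measure \<Rightarrow> 's measure \<Rightarrow> (nat \<Rightarrow> 's \<Rightarrow> real mat) \<Rightarrow> bool" where
  "iid_sketches m D M S \<longleftrightarrow>
     prob_space D \<and> space D \<subseteq> {T. dim_row T = m} \<and> prob_space M \<and>
     prob_space.indep_vars M (\<lambda>_. D) S {1..} \<and> (\<forall>k\<ge>1. distr M D (S k) = D)"

end

theory Submission
  imports Defs "Jordan_Normal_Form.Determinant"
begin

text \<open>
Fix a sample point. The two recursions have the same form, current iterate plus a step plus a
multiple of the last displacement, and \<open>phi\<close> is affine. An affine map commutes with the momentum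
term, so it suffices that its linear part \<open>inv_mat B * A\<^sup>T\<close> sends the dual direction
\<open>S * \<lambda> = H * (b - A * phi y)\<close> to the negative gradient of \<open>f_S\<close> at \<open>phi y\<close>. This is the formula
\<open>inv_mat B * A\<^sup>T * H * (A * x - b)\<close> for the gradient at \<open>x\<close>, and induction over two consecutive
iterates does the rest.

The work lies in that formula, since the gradient and the pseudoinverse are given by definite
descriptions. The pseudoinverse exists and is unique (\<open>pinv_exists\<close>, \<open>pinv_unique\<close>); existence is
reduced to that of a matrix \<open>G\<close> with \<open>N * G * N = N\<close>, which pivoting provides. Uniqueness makes the
pseudoinverse of a symmetric matrix symmetric, so \<open>H\<close> is symmetric and the linear term of the
quadratic function \<open>f_S\<close> is the expected one. The quadratic term has to be dominated by the
\<open>B\<close>-norm: it is half the squared \<open>B\<close>-length of a \<open>B\<close>-orthogonal projection of the increment, by the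
identity \<open>H * (A * inv_mat B * A\<^sup>T) * H = H\<close> (\<open>sketched_energy_bounds\<close>). Gradients for the
\<open>B\<close>-inner product are unique (\<open>has_grad_B_unique\<close>), which gives \<open>grad_f_S\<close>.
\<close>

section \<open>Matrix algebra\<close>

text \<open>The rules below repeat the ring laws for matrices with conditions on the dimensions of the
factors. Such conditions contain no variable that is absent from the left-hand side, so that
they are usable as rewrite rules on products of several matrices.\<close>
lemma mult_assoc_dim:
  fixes X Y Z :: "'a :: comm_ring_1 mat"
  assumes "dim_col X = dim_row Y" "dim_col Y = dim_row Z"
  shows "(X * Y) * Z = X * (Y * Z)"
  by (rule assoc_mult_mat[of X "dim_row X" "dim_col X" Y "dim_col Y" Z "dim_col Z"])
    (use assms in auto)

lemma mult_vec_assoc_dim: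
  fixes X Y :: "'a :: comm_ring_1 mat"
  assumes "dim_col X = dim_row Y" "dim_col Y = dim_vec v"
  shows "(X * Y) *\<^sub>v v = X *\<^sub>v (Y *\<^sub>v v)"
  by (rule assoc_mult_mat_vec[of X "dim_row X" "dim_col X" Y "dim_col Y" v])
    (use assms in \<open>auto intro: carrier_vecI\<close>)

lemma transpose_mult_dim:
  fixes X Y :: "'a :: comm_ring_1 mat"
  assumes "dim_col X = dim_row Y"
  shows "(X * Y)\<^sup>T = Y\<^sup>T * X\<^sup>T"
  by (rule transpose_mult[of X "dim_row X" "dim_col X" Y "dim_col Y"]) (use assms in auto)

lemma mult_minus_dim:
  fixes X Y Z :: "'a :: comm_ring_1 mat"
  assumes "dim_col X = dim_row Y" "dim_row Z = dim_row Y" "dim_col Z = dim_col Y"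
  shows "X * (Y - Z) = X * Y - X * Z"
  by (rule mult_minus_distrib_mat[of X "dim_row X" "dim_col X" Y "dim_col Y" Z])
    (use assms in auto)

lemma minus_mult_dim:
  fixes X Y Z :: "'a :: comm_ring_1 mat"
  assumes "dim_col X = dim_row Z" "dim_row X = dim_row Y" "dim_col X = dim_col Y"
  shows "(X - Y) * Z = X * Z - Y * Z"
  by (rule minus_mult_distrib_mat[of X "dim_row X" "dim_col X" Y Z "dim_col Z"])
    (use assms in auto)

lemma mult_add_dim:
  fixes X Y Z :: "'a :: comm_ring_1 mat"
  assumes "dim_col X = dim_row Y" "dim_row Z = dim_row Y" "dim_col Z = dim_col Y"
  shows "X * (Y + Z) = X * Y + X * Z"
  by (rule mult_add_distrib_mat[of X "dim_row X" "dim_col X" Y "dim_col Y" Z])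
    (use assms in auto)

lemma add_mult_dim:
  fixes X Y Z :: "'a :: comm_ring_1 mat"
  assumes "dim_col X = dim_row Z" "dim_row X = dim_row Y" "dim_col X = dim_col Y"
  shows "(X + Y) * Z = X * Z + Y * Z"
  by (rule add_mult_distrib_mat[of X "dim_row X" "dim_col X" Y Z "dim_col Z"])
    (use assms in auto)

lemma mult_uminus_vec_dim:
  fixes X :: "'a :: comm_ring_1 mat"
  assumes "dim_vec v = dim_col X"
  shows "X *\<^sub>v (- v) = - (X *\<^sub>v v)"
  using assms by (intro eq_vecI) auto

section \<open>The Moore-Penrose inverse\<close>

text \<open>A matrix \<open>G\<close> with \<open>N * G * N = N\<close> is called an inner inverse of \<open>N\<close>. Since
\<open>N * (1 - E * N) = (1 - N * E) * N = N - N * E * N\<close>, the matrix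
\<open>E + (1 - E * N) * G' * (1 - N * E)\<close> is an inner inverse of \<open>N\<close> whenever \<open>G'\<close> is one of the
reduced matrix.\<close>
lemma inner_inverse_from_reduction:
  fixes N E G' :: "'a :: comm_ring_1 mat"
  assumes N: "N \<in> carrier_mat r c" and E: "E \<in> carrier_mat c r" and G': "G' \<in> carrier_mat c r"
    and inner: "(N - N * E * N) * G' * (N - N * E * N) = N - N * E * N"
  shows "\<exists>G\<in>carrier_mat c r. N * G * N = N"
proof -
  define G where "G = E + (1\<^sub>m c - E * N) * G' * (1\<^sub>m r - N * E)"
  have d: "dim_row N = r" "dim_col N = c" "dim_row E = c" "dim_col E = r"
    "dim_row G' = c" "dim_col G' = r"
    using N E G' by auto
  have l: "N * (1\<^sub>m c - E * N) = N - N * E * N"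
    using N d by (simp add: mult_minus_dim mult_assoc_dim)
  have rr: "(1\<^sub>m r - N * E) * N = N - N * E * N"
    using N d by (simp add: minus_mult_dim mult_assoc_dim)
  have "N * ((1\<^sub>m c - E * N) * G' * (1\<^sub>m r - N * E)) * N
      = N * (1\<^sub>m c - E * N) * G' * ((1\<^sub>m r - N * E) * N)"
    using d by (simp add: mult_assoc_dim del: assoc_mult_mat)
  also have "\<dots> = N - N * E * N"
    unfolding l rr by (rule inner)
  finally have "N * G * N = N * E * N + (N - N * E * N)"
    unfolding G_def using d by (simp add: mult_add_dim add_mult_dim)
  also have "\<dots> = N"
    using d by (intro eq_matI) auto
  finally show ?thesis
    unfolding G_def using E G' N
    by (intro bexI[of _ "E + (1\<^sub>m c - E * N) * G' * (1\<^sub>m r - N * E)"]) auto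
qed

text \<open>Induction on the number of nonzero rows. A nonzero entry at \<open>(i, j)\<close> serves as a pivot: with
\<open>E\<close> having the reciprocal of the pivot at \<open>(j, i)\<close> and zeros elsewhere, \<open>N - N * E * N\<close> is
Wedderburn's rank reduction of \<open>N\<close>. Its row \<open>i\<close> vanishes, and every zero row of \<open>N\<close> remains
zero.\<close>
lemma inner_inverse_exists:
  fixes N :: "'a :: field mat"
  assumes "N \<in> carrier_mat r c"
  shows "\<exists>G\<in>carrier_mat c r. N * G * N = N"
  using assms
proof (induction "card {i. i < r \<and> row N i \<noteq> 0\<^sub>v c}" arbitrary: N rule: less_induct)
  case less
  note N = \<open>N \<in> carrier_mat r c\<close>
  show ?case
  proof (cases "\<exists>i<r. \<exists>j<c. N $$ (i,j) \<noteq> 0")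
    case False
    then have "N = 0\<^sub>m r c"
      using N by (intro eq_matI) auto
    then show ?thesis
      by (intro bexI[of _ "0\<^sub>m c r"]) auto
  next
    case True
    then obtain i j where i: "i < r" and j: "j < c" and nz: "N $$ (i,j) \<noteq> 0"
      by blast
    define E where "E = mat c r (\<lambda>(k,l). if k = j \<and> l = i then 1 / N $$ (i,j) else 0)"
    have E: "E \<in> carrier_mat c r"
      by (simp add: E_def)
    have EN: "(E * N) $$ (k,l) = (if k = j then N $$ (i,l) / N $$ (i,j) else 0)"
      if "k < c" "l < c" for k l
    proof -
      have "(E * N) $$ (k,l) = (\<Sum>p\<in>{0..<r}. (if p = i then (if k = j then N $$ (i,l) / N $$ (i,j) else 0) else 0))"
        using that N E i by (auto simp: scalar_prod_def E_def if_distrib[of "\<lambda>z. z * _"] intro!: sum.cong cong: if_cong)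
      then show ?thesis
        using i by simp
    qed
    have NEN: "(N * E * N) $$ (k,l) = N $$ (k,j) * N $$ (i,l) / N $$ (i,j)"
      if "k < r" "l < c" for k l
    proof -
      define F where "F = E * N"
      have F: "F \<in> carrier_mat c c"
        using E N by (auto simp: F_def)
      have "(N * E * N) $$ (k,l) = (N * F) $$ (k,l)"
        unfolding F_def using N E by simp
      also have "\<dots> = (\<Sum>p\<in>{0..<c}. N $$ (k,p) * F $$ (p,l))"
        using that N F by (auto simp: scalar_prod_def)
      also have "\<dots> = (\<Sum>p\<in>{0..<c}. (if p = j then N $$ (k,j) * N $$ (i,l) / N $$ (i,j) else 0))"
        using that by (intro sum.cong) (auto simp: F_def EN simp del: index_mult_mat(1))
      finally show ?thesis
        using j by simp
    qed
    let ?N' = "N - N * E * N"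
    have N': "?N' \<in> carrier_mat r c"
      using N E by auto
    have entry: "?N' $$ (k,l) = N $$ (k,l) - N $$ (k,j) * N $$ (i,l) / N $$ (i,j)"
      if "k < r" "l < c" for k l
      using that N E NEN[OF that] by (simp del: index_mult_mat(1) assoc_mult_mat)
    have "{k. k < r \<and> row ?N' k \<noteq> 0\<^sub>v c} \<subset> {k. k < r \<and> row N k \<noteq> 0\<^sub>v c}"
    proof
      show "{k. k < r \<and> row ?N' k \<noteq> 0\<^sub>v c} \<subseteq> {k. k < r \<and> row N k \<noteq> 0\<^sub>v c}"
      proof safe
        fix k assume k: "k < r" and "row ?N' k \<noteq> 0\<^sub>v c" and z: "row N k = 0\<^sub>v c"
        have "N $$ (k,l) = 0" if "l < c" for l
          using arg_cong[OF z, of "\<lambda>v. v $ l"] that k N by auto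
        then have "row ?N' k $ l = 0" if "l < c" for l
          using that k N' j entry[OF k that] by (simp only: index_row carrier_matD) simp
        then have "row ?N' k = 0\<^sub>v c"
          using N' by (intro eq_vecI) (auto simp del: index_mult_mat index_minus_mat index_row)
        with \<open>row ?N' k \<noteq> 0\<^sub>v c\<close> show False by blast
      qed
      have row_i: "row ?N' i $ l = 0" if "l < c" for l
        using that i N' nz entry[OF i that] by (simp only: index_row carrier_matD) simp
      have "row ?N' i = 0\<^sub>v c"
        using row_i N' by (intro eq_vecI) (auto simp del: index_mult_mat index_minus_mat index_row)
      moreover have "row N i \<noteq> 0\<^sub>v c"
      proof
        assume "row N i = 0\<^sub>v c"
        from arg_cong[OF this, of "\<lambda>v. v $ j"] show False
          using i j N nz by auto
      qed
      ultimately show "{k. k < r \<and> row ?N' k \<noteq> 0\<^sub>v c} \<noteq> {k. k < r \<and> row N k \<noteq> 0\<^sub>v c}"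
        using i by blast
    qed
    then have "card {k. k < r \<and> row ?N' k \<noteq> 0\<^sub>v c} < card {k. k < r \<and> row N k \<noteq> 0\<^sub>v c}"
      by (intro psubset_card_mono) auto
    from less.hyps[OF this N'] obtain G' where G': "G' \<in> carrier_mat c r" "?N' * G' * ?N' = ?N'"
      by blast
    show ?thesis
      by (rule inner_inverse_from_reduction[OF N E G'])
  qed
qed

text \<open>The diagonal entries of the Gram matrix are the squared lengths of the columns.\<close>
lemma gram_zero_imp_zero:
  fixes X :: "real mat"
  assumes X: "X \<in> carrier_mat r c" and zero: "X\<^sup>T * X = 0\<^sub>m c c"
  shows "X = 0\<^sub>m r c"
proof (intro eq_matI)
  fix i j assume "i < dim_row (0\<^sub>m r c)" "j < dim_col (0\<^sub>m r c)"
  then have i: "i < r" and j: "j < c" by auto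
  have "col X j \<bullet> col X j = (X\<^sup>T * X) $$ (j,j)"
    using X j by simp
  also have "\<dots> = 0"
    using zero j by simp
  finally have "(\<Sum>k\<in>{0..<r}. X $$ (k,j) * X $$ (k,j)) = 0"
    using X j by (simp add: scalar_prod_def)
  then have "\<forall>k\<in>{0..<r}. X $$ (k,j) * X $$ (k,j) = 0"
    by (subst (asm) sum_nonneg_eq_0_iff) auto
  then show "X $$ (i,j) = 0\<^sub>m r c $$ (i,j)"
    using i j by auto
qed (use X in auto)

text \<open>The kernels of \<open>M\<^sup>T * M\<close> and \<open>M\<close> agree: the Gram matrix of \<open>M * (X - Y)\<close> contains the factor
\<open>M\<^sup>T * M * (X - Y)\<close>.\<close>
lemma gram_cancel_left:
  fixes M X Y :: "real mat"
  assumes M: "M \<in> carrier_mat r c" and X: "X \<in> carrier_mat c k" and Y: "Y \<in> carrier_mat c k"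
    and eq: "M\<^sup>T * M * X = M\<^sup>T * M * Y"
  shows "M * X = M * Y"
proof -
  have d: "dim_row M = r" "dim_col M = c" "dim_row X = c" "dim_col X = k"
    "dim_row Y = c" "dim_col Y = k"
    using M X Y by auto
  let ?D = "X - Y"
  have D: "M * ?D \<in> carrier_mat r k"
    using M X Y by auto
  have "M\<^sup>T * M * ?D = 0\<^sub>m c k"
  proof -
    have "M\<^sup>T * M * ?D = M\<^sup>T * M * X - M\<^sup>T * M * Y"
      using d by (intro mult_minus_dim) auto
    then show ?thesis
      unfolding eq using d by (intro eq_matI) auto
  qed
  moreover have "(M * ?D)\<^sup>T * (M * ?D) = ?D\<^sup>T * (M\<^sup>T * M * ?D)"
    using d by (simp add: transpose_mult_dim mult_assoc_dim)
  ultimately have "(M * ?D)\<^sup>T * (M * ?D) = 0\<^sub>m k k"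
    using d by (simp add: right_mult_zero_mat[of _ k c])
  then have z: "M * ?D = 0\<^sub>m r k"
    by (rule gram_zero_imp_zero[OF D])
  have "M * X - M * Y = 0\<^sub>m r k"
    using z d by (simp add: mult_minus_dim)
  then have "(M * X - M * Y) $$ (i,j) = 0" if "i < r" "j < k" for i j
    using that by simp
  then show ?thesis
    using d by (intro eq_matI) auto
qed

text \<open>The witness is \<open>M\<^sup>T * G * M\<^sup>T\<close>, where \<open>G\<close> is an inner inverse of \<open>N = M\<^sup>T * M * M\<^sup>T\<close>. Cancelling
the Gram factors in \<open>N * G * N = N\<close> from the left and from the right gives the first Penrose
condition. The second one is immediate if also \<open>G * N * G = G\<close>, which holds once an arbitrary
inner inverse \<open>G0\<close> is replaced by \<open>G0 * N * G0\<close>.\<close>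
lemma pinv_exists:
  fixes M :: "real mat"
  shows "\<exists>P. is_pinv M P"
proof -
  define r c where "r = dim_row M" and "c = dim_col M"
  have M: "M \<in> carrier_mat r c"
    by (simp add: r_def c_def)
  define N where "N = M\<^sup>T * M * M\<^sup>T"
  have N: "N \<in> carrier_mat c r"
    using M by (auto simp: N_def)
  obtain G0 where G0: "G0 \<in> carrier_mat r c" and NG0: "N * G0 * N = N"
    using inner_inverse_exists[OF N] by blast
  define G where "G = G0 * N * G0"
  have G: "G \<in> carrier_mat r c"
    using G0 N by (auto simp: G_def)
  have d: "dim_row M = r" "dim_col M = c" "dim_row N = c" "dim_col N = r"
    "dim_row G0 = r" "dim_col G0 = c" "dim_row G = r" "dim_col G = c"
    using M N G0 G by auto
  have NGN: "N * G * N = N"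
  proof -
    have "N * G * N = N * G0 * N * G0 * N"
      unfolding G_def using d by (simp add: mult_assoc_dim)
    then show ?thesis by (simp only: NG0)
  qed
  have GNG: "G * N * G = G"
  proof -
    have "G * N * G = G0 * (N * G0 * N) * G0 * N * G0"
      unfolding G_def using d by (simp add: mult_assoc_dim)
    also have "\<dots> = G0 * (N * G0 * N) * G0"
      unfolding NG0 using d NG0 by (simp add: mult_assoc_dim)
    finally show ?thesis
      unfolding NG0 G_def .
  qed
  define P where "P = M\<^sup>T * G * M\<^sup>T"
  have P: "P \<in> carrier_mat c r"
    using M G by (auto simp: P_def)
  have dP: "dim_row P = c" "dim_col P = r"
    using P by auto
  \<comment> \<open>Cancel \<open>M\<^sup>T\<close> on the left, transpose, and cancel \<open>M\<close> on the left.\<close>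
  have "M\<^sup>T * M * (M\<^sup>T * G * N) = M\<^sup>T * M * M\<^sup>T"
    using NGN d unfolding N_def by (simp add: mult_assoc_dim)
  then have "M * (M\<^sup>T * G * N) = M * M\<^sup>T"
    using M G N by (intro gram_cancel_left[OF M, of _ r]) auto
  from arg_cong[OF this, of transpose_mat]
  have "M * M\<^sup>T * (M * G\<^sup>T * M * M\<^sup>T) = M * M\<^sup>T"
    using d unfolding N_def by (simp add: transpose_mult_dim mult_assoc_dim)
  then have "(M\<^sup>T)\<^sup>T * M\<^sup>T * (M * G\<^sup>T * M * M\<^sup>T) = (M\<^sup>T)\<^sup>T * M\<^sup>T * 1\<^sub>m r"
    using d by (simp add: mult_assoc_dim)
  then have "M\<^sup>T * (M * G\<^sup>T * M * M\<^sup>T) = M\<^sup>T * 1\<^sub>m r"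
    using M G by (intro gram_cancel_left[of "M\<^sup>T" c r _ r]) auto
  from arg_cong[OF this, of transpose_mat]
  have MPM: "M * P * M = M"
    using d M unfolding P_def by (simp add: transpose_mult_dim mult_assoc_dim)
  have PMP: "P * M * P = P"
  proof -
    have "P * M * P = M\<^sup>T * (G * N * G) * M\<^sup>T"
      unfolding P_def N_def using d by (simp add: mult_assoc_dim)
    then show ?thesis
      by (simp only: GNG P_def)
  qed
  \<comment> \<open>A matrix \<open>Q\<close> with \<open>Q * Q\<^sup>T = Q\<^sup>T\<close> is symmetric, because \<open>Q * Q\<^sup>T\<close> is.\<close>
  have sym1: "(M * P)\<^sup>T = M * P"
  proof -
    have T: "(M * P)\<^sup>T = M * (G\<^sup>T * M * M\<^sup>T)"
      unfolding P_def using d by (simp add: transpose_mult_dim mult_assoc_dim)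
    \<comment> \<open>The transpose has \<open>M\<close> as its left factor, which \<open>M * P\<close> fixes.\<close>
    have "(M * P) * (M * P)\<^sup>T = (M * P * M) * (G\<^sup>T * M * M\<^sup>T)"
      unfolding T using d dP by (simp add: mult_assoc_dim)
    then have Q: "(M * P) * (M * P)\<^sup>T = (M * P)\<^sup>T"
      unfolding MPM T .
    have "M * P = ((M * P)\<^sup>T)\<^sup>T" by simp
    also have "\<dots> = ((M * P) * (M * P)\<^sup>T)\<^sup>T" by (simp only: Q)
    also have "\<dots> = (M * P) * (M * P)\<^sup>T"
      using d dP by (subst transpose_mult_dim) auto
    finally show ?thesis using Q by simp
  qed
  have sym2: "(P * M)\<^sup>T = P * M"
  proof -
    have "(P * M)\<^sup>T * (P * M) = (M * P * M)\<^sup>T * (G * M\<^sup>T * M)"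
      unfolding P_def using d by (simp add: transpose_mult_dim mult_assoc_dim)
    also have "\<dots> = P * M"
      unfolding MPM using d by (simp add: P_def mult_assoc_dim)
    finally have R: "(P * M)\<^sup>T * (P * M) = P * M" .
    have "(P * M)\<^sup>T = ((P * M)\<^sup>T * (P * M))\<^sup>T" by (simp only: R)
    also have "\<dots> = (P * M)\<^sup>T * (P * M)"
      using d dP by (subst transpose_mult_dim) auto
    finally show ?thesis using R by simp
  qed
  have "is_pinv M P"
    unfolding is_pinv_def using P MPM PMP sym1 sym2 d by auto
  then show ?thesis ..
qed

text \<open>Two matrices that satisfy the Penrose conditions yield the same orthogonal projections
\<open>M * P = M * Q\<close> and \<open>P * M = Q * M\<close>, because each projection absorbs the other one and both are
symmetric.\<close>
lemma pinv_unique: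
  assumes P: "is_pinv M P" and Q: "is_pinv M Q"
  shows "P = Q"
proof -
  have d: "dim_row P = dim_col M" "dim_col P = dim_row M"
    "dim_row Q = dim_col M" "dim_col Q = dim_row M"
    using P Q by (auto simp: is_pinv_def)
  have P1: "M * P * M = M" and P2: "P * M * P = P"
    and P3: "(M * P)\<^sup>T = M * P" and P4: "(P * M)\<^sup>T = P * M"
    using P by (auto simp: is_pinv_def)
  have Q1: "M * Q * M = M" and Q2: "Q * M * Q = Q"
    and Q3: "(M * Q)\<^sup>T = M * Q" and Q4: "(Q * M)\<^sup>T = Q * M"
    using Q by (auto simp: is_pinv_def)
  have "M * P = (M * Q * M * P)\<^sup>T"
    by (simp only: Q1 P3)
  also have "\<dots> = (M * P)\<^sup>T * (M * Q)\<^sup>T"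
    using d by (simp add: mult_assoc_dim flip: transpose_mult_dim)
  also have "\<dots> = (M * P * M) * Q"
    unfolding P3 Q3 using d by (simp add: mult_assoc_dim)
  finally have MP: "M * P = M * Q"
    unfolding P1 .
  have "P * M = (P * (M * Q * M))\<^sup>T"
    by (simp only: Q1 P4)
  also have "\<dots> = (Q * M)\<^sup>T * (P * M)\<^sup>T"
    using d by (simp add: mult_assoc_dim flip: transpose_mult_dim)
  also have "\<dots> = Q * (M * P * M)"
    unfolding P4 Q4 using d by (simp add: mult_assoc_dim)
  finally have PM: "P * M = Q * M"
    unfolding P1 .
  have "P = P * M * P" by (simp only: P2)
  also have "\<dots> = Q * (M * P)"
    unfolding PM using d by (simp add: mult_assoc_dim)
  also have "\<dots> = Q * M * Q"
    unfolding MP using d by (simp add: mult_assoc_dim)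
  finally show ?thesis
    unfolding Q2 .
qed

lemma is_pinv_pinv: "is_pinv M (pinv M)"
proof -
  obtain P where P: "is_pinv M P"
    using pinv_exists by blast
  show ?thesis
    unfolding pinv_def by (rule theI[of "is_pinv M", OF P]) (rule pinv_unique[OF _ P])
qed

text \<open>The transpose of a pseudoinverse satisfies the Penrose conditions for the transposed matrix, so
uniqueness applies.\<close>
lemma pinv_symmetric:
  assumes sym: "M\<^sup>T = M"
  shows "(pinv M)\<^sup>T = pinv M"
proof (rule pinv_unique)
  have sq: "dim_col M = dim_row M"
    using arg_cong[OF sym, of dim_row] by simp
  have P: "pinv M \<in> carrier_mat (dim_row M) (dim_row M)"
    and P1: "M * pinv M * M = M" and P2: "pinv M * M * pinv M = pinv M"
    and P3: "(M * pinv M)\<^sup>T = M * pinv M" and P4: "(pinv M * M)\<^sup>T = pinv M * M"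
    using is_pinv_pinv[of M] sq by (auto simp: is_pinv_def)
  have d: "dim_row (pinv M) = dim_row M" "dim_col (pinv M) = dim_row M"
    using P by auto
  have r: "M * (pinv M)\<^sup>T = pinv M * M"
    using P4 d sq by (simp add: transpose_mult_dim sym)
  have l: "(pinv M)\<^sup>T * M = M * pinv M"
    using P3 d sq by (simp add: transpose_mult_dim sym)
  have 1: "M * (pinv M)\<^sup>T * M = M"
    using arg_cong[OF P1, of transpose_mat] d sq
    by (simp add: transpose_mult_dim mult_assoc_dim sym)
  have 2: "(pinv M)\<^sup>T * M * (pinv M)\<^sup>T = (pinv M)\<^sup>T"
    using arg_cong[OF P2, of transpose_mat] d sq
    by (simp add: transpose_mult_dim mult_assoc_dim sym)
  show "is_pinv M ((pinv M)\<^sup>T)"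
    unfolding is_pinv_def using P sq 1 2 P3 P4 by (simp add: l r)
qed (rule is_pinv_pinv)

section \<open>The inner product of a positive definite matrix\<close>

lemma adjoint_scalar_prod:
  fixes X :: "real mat"
  assumes "X \<in> carrier_mat r c" "u \<in> carrier_vec r" "v \<in> carrier_vec c"
  shows "u \<bullet> (X *\<^sub>v v) = (X\<^sup>T *\<^sub>v u) \<bullet> v"
  using transpose_vec_mult_scalar[OF assms(1,3,2)] by simp

lemma sym_pos_defD:
  assumes "sym_pos_def n B"
  shows "B \<in> carrier_mat n n" "B\<^sup>T = B"
    "v \<in> carrier_vec n \<Longrightarrow> v \<noteq> 0\<^sub>v n \<Longrightarrow> inner_B B v v > 0"
  using assms by (auto simp: sym_pos_def_def inner_B_def)

text \<open>A positive definite matrix has trivial kernel, hence nonzero determinant, so that the optional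
inverse in the definition of \<open>inv_mat\<close> is present.\<close>
lemma sym_pos_def_inverse:
  assumes B: "sym_pos_def n B"
  shows "inv_mat B \<in> carrier_mat n n" "B * inv_mat B = 1\<^sub>m n" "inv_mat B * B = 1\<^sub>m n"
    "(inv_mat B)\<^sup>T = inv_mat B"
proof -
  note Bc = sym_pos_defD(1)[OF B] and Bs = sym_pos_defD(2)[OF B]
  have "det B \<noteq> 0"
  proof
    assume "det B = 0"
    then obtain v where "v \<in> carrier_vec n" "v \<noteq> 0\<^sub>v n" "B *\<^sub>v v = 0\<^sub>v n"
      using det_0_iff_vec_prod_zero_field[OF Bc] by blast
    then show False
      using sym_pos_defD(3)[OF B, of v] by (simp add: inner_B_def)
  qed
  from det_non_zero_imp_unit[OF Bc this, of "()"]
  obtain C where "mat_inverse B = Some C"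
    using mat_inverse(1)[OF Bc, of "()"] by (cases "mat_inverse B") auto
  with mat_inverse(2)[OF Bc this]
  show C: "inv_mat B \<in> carrier_mat n n" and BC: "B * inv_mat B = 1\<^sub>m n"
    and CB: "inv_mat B * B = 1\<^sub>m n"
    by (auto simp: inv_mat_def)
  let ?C = "inv_mat B"
  have "?C\<^sup>T = ?C\<^sup>T * (B * ?C)"
    using C BC by simp
  also have "\<dots> = (B * ?C)\<^sup>T * ?C"
    using Bc C by (simp add: transpose_mult_dim mult_assoc_dim Bs)
  finally show "?C\<^sup>T = ?C"
    using C BC by simp
qed

lemma inner_B_commute:
  assumes B: "sym_pos_def n B" and "u \<in> carrier_vec n" "v \<in> carrier_vec n"
  shows "inner_B B u v = inner_B B v u"
  using adjoint_scalar_prod[of B n n u v] comm_scalar_prod[of v n "B *\<^sub>v u"]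
    sym_pos_defD(1,2)[OF B] assms(2,3) by (simp add: inner_B_def)

lemma inner_B_self_nonneg:
  assumes B: "sym_pos_def n B" and v: "v \<in> carrier_vec n"
  shows "inner_B B v v \<ge> 0"
  using sym_pos_defD[OF B] v by (cases "v = 0\<^sub>v n") (force simp: inner_B_def)+

lemma inner_B_diff_left:
  assumes B: "sym_pos_def n B"
    and "u \<in> carrier_vec n" "v \<in> carrier_vec n" "w \<in> carrier_vec n"
  shows "inner_B B (u - v) w = inner_B B u w - inner_B B v w"
  using sym_pos_defD(1)[OF B] assms(2-4)
  by (simp add: inner_B_def minus_scalar_prod_distrib[of _ n])

lemma inner_B_diff_self:
  assumes B: "sym_pos_def n B" and u: "u \<in> carrier_vec n" and v: "v \<in> carrier_vec n"
  shows "inner_B B (u - v) (u - v) = inner_B B u u - 2 * inner_B B v u + inner_B B v v"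
proof -
  have uv: "u - v \<in> carrier_vec n"
    using u v by simp
  have "inner_B B (u - v) (u - v) = inner_B B u (u - v) - inner_B B v (u - v)"
    by (rule inner_B_diff_left[OF B u v uv])
  also have "\<dots> = inner_B B (u - v) u - inner_B B (u - v) v"
    by (simp only: inner_B_commute[OF B u uv] inner_B_commute[OF B v uv])
  also have "\<dots> = inner_B B u u - inner_B B v u - (inner_B B u v - inner_B B v v)"
    by (simp only: inner_B_diff_left[OF B u v u] inner_B_diff_left[OF B u v v])
  finally show ?thesis
    using inner_B_commute[OF B u v] by simp
qed

lemma norm_B_smult:
  assumes B: "sym_pos_def n B" and v: "v \<in> carrier_vec n" and t: "t \<ge> 0"
  shows "norm_B B (t \<cdot>\<^sub>v v) = t * norm_B B v"
proof -
  have "inner_B B (t \<cdot>\<^sub>v v) (t \<cdot>\<^sub>v v) = t\<^sup>2 * inner_B B v v"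
    using sym_pos_defD(1)[OF B] v
    by (simp add: inner_B_def mult_mat_vec power2_eq_square)
  then show ?thesis
    using t by (simp add: norm_B_def real_sqrt_mult)
qed

text \<open>Along the direction \<open>u = g - g'\<close> the two linear approximations differ by \<open>t * (norm_B B u)\<^sup>2\<close> at
distance \<open>t * norm_B B u\<close>. This difference is of first order in \<open>t\<close>, whereas both
approximation errors are \<open>o(t)\<close>.\<close>
lemma has_grad_B_unique:
  assumes B: "sym_pos_def n B" and g: "has_grad_B B f g x" and g': "has_grad_B B f g' x"
  shows "g = g'"
proof (rule ccontr)
  assume ne: "g \<noteq> g'"
  note Bc = sym_pos_defD(1)[OF B]
  have gc: "g \<in> carrier_vec n" and gc': "g' \<in> carrier_vec n"
    using g g' Bc by (auto simp: has_grad_B_def)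
  define u where "u = g - g'"
  have u: "u \<in> carrier_vec n"
    using gc gc' by (simp add: u_def)
  have "u \<noteq> 0\<^sub>v n"
  proof
    assume z: "u = 0\<^sub>v n"
    have "g = g'"
    proof (rule eq_vecI)
      fix i assume "i < dim_vec g'"
      then show "g $ i = g' $ i"
        using arg_cong[OF z, of "\<lambda>v. v $ i"] gc gc' by (auto simp: u_def)
    qed (use gc gc' in auto)
    with ne show False ..
  qed
  then have pos: "inner_B B u u > 0"
    by (rule sym_pos_defD(3)[OF B u])
  define N where "N = norm_B B u"
  have N: "N > 0" and N2: "inner_B B u u = N * N"
    using pos by (auto simp: N_def norm_B_def)
  have near: "\<exists>d>0. \<forall>h\<in>carrier_vec n. norm_B B h < d
      \<longrightarrow> \<bar>f (x + h) - f x - inner_B B v h\<bar> \<le> N / 4 * norm_B B h"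
    if "has_grad_B B f v x" for v
  proof -
    have "N / 4 > 0"
      using N by simp
    with that show ?thesis
      unfolding has_grad_B_def carrier_matD(1)[OF Bc] by blast
  qed
  obtain d where d: "d > 0"
    and gd: "\<And>h. h \<in> carrier_vec n \<Longrightarrow> norm_B B h < d
      \<Longrightarrow> \<bar>f (x + h) - f x - inner_B B g h\<bar> \<le> N / 4 * norm_B B h"
    using near[OF g] by blast
  obtain d' where d': "d' > 0"
    and gd': "\<And>h. h \<in> carrier_vec n \<Longrightarrow> norm_B B h < d'
      \<Longrightarrow> \<bar>f (x + h) - f x - inner_B B g' h\<bar> \<le> N / 4 * norm_B B h"
    using near[OF g'] by blast
  \<comment> \<open>The factor 2 keeps \<open>t * N\<close> strictly below both radii.\<close>
  define t where "t = min d d' / (2 * N)"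
  have t: "t > 0" and tN: "t * N < d" "t * N < d'"
    using d d' N by (auto simp: t_def min_def)
  have h: "t \<cdot>\<^sub>v u \<in> carrier_vec n" and nh: "norm_B B (t \<cdot>\<^sub>v u) = t * N"
    using u t norm_B_smult[OF B u] by (auto simp: N_def)
  have "inner_B B g (t \<cdot>\<^sub>v u) - inner_B B g' (t \<cdot>\<^sub>v u) = inner_B B u (t \<cdot>\<^sub>v u)"
    using inner_B_diff_left[OF B gc gc' h] by (simp add: u_def)
  also have "\<dots> = t * (N * N)"
    using u Bc N2 by (simp add: inner_B_def mult_mat_vec)
  finally have eq: "inner_B B g (t \<cdot>\<^sub>v u) - inner_B B g' (t \<cdot>\<^sub>v u) = t * (N * N)" .
  have "t * (N * N) \<le> 2 * (N / 4 * (t * N))"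
    using gd[OF h] gd'[OF h] tN eq unfolding nh by linarith
  moreover have "t * (N * N) > 0"
    using t N by simp
  ultimately show False
    by (simp add: algebra_simps)
qed

section \<open>The gradient of the sketched residual\<close>

text \<open>The third identity is the second Penrose condition of the sketched matrix
\<open>S\<^sup>T * A * inv_mat B * A\<^sup>T * S\<close>, framed by \<open>S\<close> and \<open>S\<^sup>T\<close>. It makes
\<open>inv_mat B * A\<^sup>T * H * A\<close> idempotent.\<close>
lemma H_mat_properties:
  assumes A: "A \<in> carrier_mat m n" and B: "sym_pos_def n B" and S: "dim_row S = m"
  shows "H_mat A B S \<in> carrier_mat m m" "(H_mat A B S)\<^sup>T = H_mat A B S"
    "H_mat A B S * (A * inv_mat B * A\<^sup>T) * H_mat A B S = H_mat A B S"
    "sketch_pinv A B S \<in> carrier_mat (dim_col S) (dim_col S)"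
proof -
  note C = sym_pos_def_inverse(1,4)[OF B]
  define K where "K = A * inv_mat B * A\<^sup>T"
  define W where "W = S\<^sup>T * K * S"
  have K: "dim_row K = m" "dim_col K = m" "K\<^sup>T = K"
    using A C by (auto simp: K_def transpose_mult_dim mult_assoc_dim)
  have W: "dim_row W = dim_col S" "dim_col W = dim_col S" "W\<^sup>T = W"
    using K S by (auto simp: W_def transpose_mult_dim mult_assoc_dim)
  have P: "sketch_pinv A B S = pinv W"
    using A C S by (simp add: sketch_pinv_def W_def K_def mult_assoc_dim)
  have Pc: "pinv W \<in> carrier_mat (dim_col S) (dim_col S)" and PWP: "pinv W * W * pinv W = pinv W"
    using is_pinv_pinv[of W] W by (auto simp: is_pinv_def)
  show "sketch_pinv A B S \<in> carrier_mat (dim_col S) (dim_col S)"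
    using Pc P by simp
  have d: "dim_row (pinv W) = dim_col S" "dim_col (pinv W) = dim_col S"
    using Pc by auto
  have H: "H_mat A B S = S * pinv W * S\<^sup>T"
    by (simp add: H_mat_def P)
  show "H_mat A B S \<in> carrier_mat m m"
    using S by (auto simp: H)
  show "(H_mat A B S)\<^sup>T = H_mat A B S"
    using d S pinv_symmetric[OF W(3)] by (simp add: H transpose_mult_dim mult_assoc_dim)
  have "H_mat A B S * K * H_mat A B S = S * (pinv W * W * pinv W) * S\<^sup>T"
    using d S K(1,2) by (simp add: H W_def mult_assoc_dim)
  then show "H_mat A B S * (A * inv_mat B * A\<^sup>T) * H_mat A B S = H_mat A B S"
    by (simp only: PWP H K_def)
qed

text \<open>The map \<open>h \<mapsto> p = inv_mat B * A\<^sup>T * H * A * h\<close> is the \<open>B\<close>-orthogonal projection onto the range of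
\<open>inv_mat B * A\<^sup>T * S\<close>, and the quadratic form of \<open>H\<close> at \<open>A * h\<close> is the squared \<open>B\<close>-length of \<open>p\<close>.
The bounds are therefore nonnegativity of a squared length and the fact that an orthogonal
projection does not increase lengths. They control the second-order remainder of \<open>f_S\<close> without
any comparison of the \<open>B\<close>-norm with another norm.\<close>
lemma sketched_energy_bounds:
  assumes A: "A \<in> carrier_mat m n" and B: "sym_pos_def n B" and S: "dim_row S = m"
    and h: "h \<in> carrier_vec n"
  shows "0 \<le> (A *\<^sub>v h) \<bullet> (H_mat A B S *\<^sub>v (A *\<^sub>v h))"
    and "(A *\<^sub>v h) \<bullet> (H_mat A B S *\<^sub>v (A *\<^sub>v h)) \<le> inner_B B h h"
proof -
  let ?H = "H_mat A B S" and ?C = "inv_mat B"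
  note Bc = sym_pos_defD(1)[OF B]
  note C = sym_pos_def_inverse[OF B]
  note H = H_mat_properties(1-3)[OF A B S]
  define w where "w = A *\<^sub>v h"
  define q where "q = A\<^sup>T *\<^sub>v (?H *\<^sub>v w)"
  \<comment> \<open>This is the projection of \<open>h\<close>; the bounds follow by expanding \<open>inner_B B (h - p) (h - p)\<close>.\<close>
  define p where "p = ?C *\<^sub>v q"
  have w: "w \<in> carrier_vec m"
    using A h by (simp add: w_def)
  have Hw: "?H *\<^sub>v w \<in> carrier_vec m"
    using H w by simp
  have q: "q \<in> carrier_vec n"
    using A Hw by (simp add: q_def)
  have p: "p \<in> carrier_vec n"
    using C q by (simp add: p_def)
  have Bp: "B *\<^sub>v p = q"
    using C Bc q by (simp add: p_def flip: assoc_mult_mat_vec)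
  have q_prod: "q \<bullet> v = (?H *\<^sub>v w) \<bullet> (A *\<^sub>v v)" if "v \<in> carrier_vec n" for v
    using adjoint_scalar_prod[OF A Hw that] by (simp add: q_def)
  have ph: "inner_B B p h = w \<bullet> (?H *\<^sub>v w)"
  proof -
    have "inner_B B p h = h \<bullet> q"
      using inner_B_commute[OF B p h] by (simp add: inner_B_def Bp)
    then show ?thesis
      using q_prod[OF h] comm_scalar_prod[OF h q] comm_scalar_prod[OF Hw w] by (simp add: w_def)
  qed
  define K where "K = A * ?C * A\<^sup>T"
  have K: "K \<in> carrier_mat m m"
    using A C(1) by (auto simp: K_def)
  have z: "K *\<^sub>v (?H *\<^sub>v w) \<in> carrier_vec m"
    using K Hw by simp
  have "inner_B B p p = q \<bullet> p"
    using comm_scalar_prod[OF p q] by (simp add: inner_B_def Bp)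
  also have "\<dots> = (?H *\<^sub>v w) \<bullet> (K *\<^sub>v (?H *\<^sub>v w))"
    unfolding q_prod[OF p]
    using carrier_matD[OF A] carrier_matD[OF C(1)] carrier_matD[OF H(1)] w
    by (simp add: p_def q_def K_def mult_vec_assoc_dim)
  also have "\<dots> = w \<bullet> (?H *\<^sub>v (K *\<^sub>v (?H *\<^sub>v w)))"
    by (simp only: adjoint_scalar_prod[OF H(1) w z] H(2))
  also have "\<dots> = w \<bullet> ((?H * K * ?H) *\<^sub>v w)"
    using carrier_matD[OF K] carrier_matD[OF H(1)] carrier_vecD[OF w]
    by (simp add: mult_vec_assoc_dim)
  finally have pp: "inner_B B p p = w \<bullet> (?H *\<^sub>v w)"
    unfolding K_def H(3) .
  show "0 \<le> (A *\<^sub>v h) \<bullet> (?H *\<^sub>v (A *\<^sub>v h))"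
    using inner_B_self_nonneg[OF B p] pp by (simp add: w_def)
  show "(A *\<^sub>v h) \<bullet> (?H *\<^sub>v (A *\<^sub>v h)) \<le> inner_B B h h"
    using inner_B_self_nonneg[OF B, of "h - p"] inner_B_diff_self[OF B h p] h p pp ph
    by (simp add: w_def)
qed

text \<open>Since \<open>H\<close> is symmetric, the increment of \<open>f_S\<close> along \<open>h\<close> is exactly the linear term plus half
the sketched energy of \<open>h\<close>, and the latter is at most half the squared \<open>B\<close>-norm of \<open>h\<close>. The
factor \<open>inv_mat B\<close> converts the Euclidean gradient into the gradient for the \<open>B\<close>-inner
product.\<close>
lemma grad_f_S:
  assumes A: "A \<in> carrier_mat m n" and B: "sym_pos_def n B" and S: "dim_row S = m"
    and b: "b \<in> carrier_vec m" and x: "x \<in> carrier_vec n"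
  shows "grad_B B (f_S A B b S) x =
    (inv_mat B * A\<^sup>T) *\<^sub>v (H_mat A B S *\<^sub>v (A *\<^sub>v x - b))"
proof -
  let ?H = "H_mat A B S" and ?C = "inv_mat B"
  define r where "r = A *\<^sub>v x - b"
  define g where "g = (?C * A\<^sup>T) *\<^sub>v (?H *\<^sub>v r)"
  note Bc = sym_pos_defD(1)[OF B]
  note C = sym_pos_def_inverse[OF B]
  note H = H_mat_properties(1,2)[OF A B S]
  have r: "r \<in> carrier_vec m"
    using A b x by (simp add: r_def)
  have Hr: "?H *\<^sub>v r \<in> carrier_vec m"
    using H r by simp
  have g: "g \<in> carrier_vec n"
    using A C Hr unfolding g_def by (intro mult_mat_vec_carrier[of _ n m] mult_carrier_mat[of _ n n]) auto
  have Bg: "B *\<^sub>v g = A\<^sup>T *\<^sub>v (?H *\<^sub>v r)"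
  proof -
    have "B *\<^sub>v g = (B * ?C) *\<^sub>v (A\<^sup>T *\<^sub>v (?H *\<^sub>v r))"
      using A Bc C(1) Hr by (simp add: g_def mult_vec_assoc_dim)
    then show ?thesis
      using A C Hr by simp
  qed
  have remainder: "f_S A B b S (x + h) - f_S A B b S x - inner_B B g h
      = 1 / 2 * ((A *\<^sub>v h) \<bullet> (?H *\<^sub>v (A *\<^sub>v h)))"
    if h: "h \<in> carrier_vec n" for h
  proof -
    define w where "w = A *\<^sub>v h"
    have w: "w \<in> carrier_vec m"
      using A h by (simp add: w_def)
    have Hw: "?H *\<^sub>v w \<in> carrier_vec m"
      using H w by simp
    have res: "A *\<^sub>v (x + h) - b = r + w"
      using A b x h by (intro eq_vecI) (auto simp: r_def w_def mult_add_distrib_mat_vec[of _ m n] simp del: index_mult_mat_vec)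
    have cross: "r \<bullet> (?H *\<^sub>v w) = (?H *\<^sub>v r) \<bullet> w"
      using adjoint_scalar_prod[OF H(1) r w] by (simp add: H(2))
    have "inner_B B g h = h \<bullet> (B *\<^sub>v g)"
      using inner_B_commute[OF B g h] by (simp add: inner_B_def)
    also have "\<dots> = (A\<^sup>T *\<^sub>v (?H *\<^sub>v r)) \<bullet> h"
      unfolding Bg using A Hr by (intro comm_scalar_prod[OF h]) simp
    also have "\<dots> = (?H *\<^sub>v r) \<bullet> w"
      using adjoint_scalar_prod[OF A Hr h] by (simp add: w_def)
    finally have lin: "inner_B B g h = (?H *\<^sub>v r) \<bullet> w" .
    have "(r + w) \<bullet> (?H *\<^sub>v (r + w))
        = r \<bullet> (?H *\<^sub>v r) + 2 * ((?H *\<^sub>v r) \<bullet> w) + w \<bullet> (?H *\<^sub>v w)"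
      using r w Hr Hw cross comm_scalar_prod[OF w Hr]
      by (simp add: mult_add_distrib_mat_vec[OF H(1) r w] add_scalar_prod_distrib[of _ m]
          scalar_prod_add_distrib[of _ m])
    then show ?thesis
      unfolding f_S_def res lin r_def[symmetric] w_def[symmetric] by linarith
  qed
  have grad: "has_grad_B B (f_S A B b S) g x"
    unfolding has_grad_B_def
  proof (intro conjI allI impI)
    show "g \<in> carrier_vec (dim_row B)"
      using g Bc by simp
    fix e :: real assume e: "e > 0"
    show "\<exists>d>0. \<forall>h\<in>carrier_vec (dim_row B). norm_B B h < d \<longrightarrow>
        \<bar>f_S A B b S (x + h) - f_S A B b S x - inner_B B g h\<bar> \<le> e * norm_B B h"
    \<comment> \<open>The remainder is quadratic, so the radius \<open>e\<close> itself is small enough.\<close>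
    proof (intro exI[of _ e] conjI ballI impI e)
      fix h assume "h \<in> carrier_vec (dim_row B)" and small: "norm_B B h < e"
      then have h: "h \<in> carrier_vec n"
        using Bc by simp
      have nonneg: "norm_B B h \<ge> 0"
        using inner_B_self_nonneg[OF B h] by (simp add: norm_B_def)
      have "(A *\<^sub>v h) \<bullet> (?H *\<^sub>v (A *\<^sub>v h)) \<le> norm_B B h * norm_B B h"
        using sketched_energy_bounds(2)[OF A B S h] inner_B_self_nonneg[OF B h]
        by (simp add: norm_B_def)
      also have "\<dots> \<le> e * norm_B B h"
        using small nonneg by (intro mult_right_mono) auto
      finally show "\<bar>f_S A B b S (x + h) - f_S A B b S x - inner_B B g h\<bar> \<le> e * norm_B B h"
        unfolding remainder[OF h] using sketched_energy_bounds(1)[OF A B S h] by simp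
    qed
  qed
  have "grad_B B (f_S A B b S) x = g"
    unfolding grad_B_def using grad has_grad_B_unique[OF B _ grad] by blast
  then show ?thesis
    by (simp add: g_def r_def)
qed

section \<open>Dual and primal iterations\<close>

lemma mSDSA_step_eq:
  assumes A: "A \<in> carrier_mat m n" and B: "sym_pos_def n B" and S: "dim_row S = m"
    and b: "b \<in> carrier_vec m" and x0: "x0 \<in> carrier_vec n" and y: "y \<in> carrier_vec m"
  shows "mSDSA_step A B b x0 \<omega> \<beta> S y y' =
    y + \<omega> \<cdot>\<^sub>v (H_mat A B S *\<^sub>v (b - A *\<^sub>v phi A B x0 y)) + \<beta> \<cdot>\<^sub>v (y - y')"
proof -
  have "S *\<^sub>v mSDSA_lambda A B b x0 S y = H_mat A B S *\<^sub>v (b - A *\<^sub>v phi A B x0 y)"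
    using S carrier_matD[OF H_mat_properties(4)[OF A B S]] carrier_matD(1)[OF A]
    by (simp add: mSDSA_lambda_def H_mat_def phi_def mult_vec_assoc_dim)
  then show ?thesis
    by (simp add: mSDSA_step_def)
qed

text \<open>The map \<open>phi\<close> is affine with linear part \<open>J = inv_mat B * A\<^sup>T\<close>. Hence it sends the dual
direction \<open>H * (b - A * phi y)\<close> to the negative gradient of \<open>f_S\<close> at \<open>phi y\<close>, while the constant
\<open>x0\<close> cancels in the momentum term.\<close>
lemma phi_mSDSA_step:
  assumes A: "A \<in> carrier_mat m n" and B: "sym_pos_def n B" and S: "dim_row S = m"
    and b: "b \<in> carrier_vec m" and x0: "x0 \<in> carrier_vec n"
    and y: "y \<in> carrier_vec m" and y': "y' \<in> carrier_vec m"
  shows "phi A B x0 (mSDSA_step A B b x0 \<omega> \<beta> S y y')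
    = mSGD_step A B b \<omega> \<beta> S (phi A B x0 y) (phi A B x0 y')"
proof -
  let ?H = "H_mat A B S"
  define J where "J = inv_mat B * A\<^sup>T"
  define v where "v = ?H *\<^sub>v (b - A *\<^sub>v phi A B x0 y)"
  have J: "J \<in> carrier_mat n m"
    using A sym_pos_def_inverse(1)[OF B] by (auto simp: J_def)
  note H = H_mat_properties(1)[OF A B S]
  have phi: "phi A B x0 z = x0 + J *\<^sub>v z" for z
    by (simp add: phi_def J_def)
  have p: "phi A B x0 y \<in> carrier_vec n"
    using J x0 y by (simp add: phi)
  have Ap: "A *\<^sub>v phi A B x0 y \<in> carrier_vec m"
    using A p by simp
  have v: "v \<in> carrier_vec m"
    using H Ap b by (simp add: v_def)
  have neg: "u - u' = - (u' - u)" if "u \<in> carrier_vec m" "u' \<in> carrier_vec m"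
    for u u' :: "real vec"
    using that by (intro eq_vecI) auto
  from neg[OF Ap b] have "?H *\<^sub>v (A *\<^sub>v phi A B x0 y - b) = - v"
    using carrier_matD[OF H] carrier_matD(1)[OF A] carrier_vecD[OF b]
    by (simp add: v_def mult_uminus_vec_dim)
  then have grad: "grad_B B (f_S A B b S) (phi A B x0 y) = - (J *\<^sub>v v)"
    using grad_f_S[OF A B S b p] carrier_matD[OF J] carrier_vecD[OF v]
    by (simp add: mult_uminus_vec_dim flip: J_def)
  have Jy: "J *\<^sub>v y \<in> carrier_vec n" "J *\<^sub>v y' \<in> carrier_vec n" "J *\<^sub>v v \<in> carrier_vec n"
    using J y y' v by auto
  have "J *\<^sub>v (y + \<omega> \<cdot>\<^sub>v v + \<beta> \<cdot>\<^sub>v (y - y'))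
      = J *\<^sub>v (y + \<omega> \<cdot>\<^sub>v v) + J *\<^sub>v (\<beta> \<cdot>\<^sub>v (y - y'))"
    by (rule mult_add_distrib_mat_vec[OF J]) (use y y' v in auto)
  also have "J *\<^sub>v (y + \<omega> \<cdot>\<^sub>v v) = J *\<^sub>v y + \<omega> \<cdot>\<^sub>v (J *\<^sub>v v)"
    using y v by (simp add: mult_add_distrib_mat_vec[OF J] mult_mat_vec[OF J])
  also have "J *\<^sub>v (\<beta> \<cdot>\<^sub>v (y - y')) = \<beta> \<cdot>\<^sub>v (J *\<^sub>v y - J *\<^sub>v y')"
    using y y' by (simp add: mult_minus_distrib_mat_vec[OF J] mult_mat_vec[OF J])
  finally have lin: "J *\<^sub>v (y + \<omega> \<cdot>\<^sub>v v + \<beta> \<cdot>\<^sub>v (y - y'))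
      = J *\<^sub>v y + \<omega> \<cdot>\<^sub>v (J *\<^sub>v v) + \<beta> \<cdot>\<^sub>v (J *\<^sub>v y - J *\<^sub>v y')" .
  have d: "dim_vec x0 = n" "dim_row J = n"
    using x0 J by auto
  show ?thesis
    unfolding mSDSA_step_eq[OF A B S b x0 y] mSGD_step_def grad v_def[symmetric]
    unfolding phi lin
    using d by (intro eq_vecI) (simp_all del: index_mult_mat_vec)
qed

text \<open>Random variables map every sample point, not only almost every one, into the space of their
distribution, and the matrices there have \<open>m\<close> rows.\<close>
lemma iid_sketches_dim_row:
  assumes S: "iid_sketches m D M S" and k: "k \<ge> 1" and s: "s \<in> space M"
  shows "dim_row (S k s) = m"
proof -
  interpret prob_space M
    using S by (simp add: iid_sketches_def)
  have "S k \<in> measurable M D"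
    using S k by (auto simp: iid_sketches_def indep_vars_def2)
  from measurable_space[OF this s] show ?thesis
    using S by (auto simp: iid_sketches_def)
qed

theorem theorem5:
  fixes m n :: nat
    and A B :: "real mat"
    and b x0 :: "real vec"
    and \<omega> \<beta> :: real
    and D :: "real mat measure"
    and M :: "'s measure"
    and S :: "nat \<Rightarrow> 's \<Rightarrow> real mat"
    and x y :: "nat \<Rightarrow> 's \<Rightarrow> real vec"
  assumes A: "A \<in> carrier_mat m n"
    and b: "b \<in> carrier_vec m"
    and consistent: "\<exists>z\<in>carrier_vec n. A *\<^sub>v z = b"
    and B: "sym_pos_def n B"
    and S: "iid_sketches m D M S"
    and stepsize: "\<omega> > 0"
    and momentum: "\<beta> \<ge> 0"
    and x0: "x0 \<in> carrier_vec n"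
    and x_init: "\<And>s. s \<in> space M \<Longrightarrow> x 0 s = x0 \<and> x 1 s = x0"
    and mSGD: "\<And>s k. s \<in> space M \<Longrightarrow> k \<ge> 1 \<Longrightarrow>
      x (k + 1) s = mSGD_step A B b \<omega> \<beta> (S k s) (x k s) (x (k - 1) s)"
    and y_init: "\<And>s. s \<in> space M \<Longrightarrow> y 0 s = 0\<^sub>v m \<and> y 1 s = 0\<^sub>v m"
    and mSDSA: "\<And>s k. s \<in> space M \<Longrightarrow> k \<ge> 1 \<Longrightarrow>
      y (k + 1) s = mSDSA_step A B b x0 \<omega> \<beta> (S k s) (y k s) (y (k - 1) s)"
  shows "\<forall>s\<in>space M. \<forall>k. x k s = phi A B x0 (y k s)"
proof
  fix s assume s: "s \<in> space M"
  \<comment> \<open>A step uses the two preceding iterates, so the induction carries two consecutive ones.\<close>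
  have "x k s = phi A B x0 (y k s) \<and> x (k + 1) s = phi A B x0 (y (k + 1) s)
      \<and> y k s \<in> carrier_vec m \<and> y (k + 1) s \<in> carrier_vec m" for k
  proof (induction k)
    case 0
    define J where "J = inv_mat B * A\<^sup>T"
    have "J \<in> carrier_mat n m"
      using A sym_pos_def_inverse(1)[OF B] by (auto simp: J_def)
    then have "J *\<^sub>v 0\<^sub>v m = 0\<^sub>v n"
      by (intro eq_vecI) auto
    then have "phi A B x0 (0\<^sub>v m) = x0"
      using x0 by (simp add: phi_def J_def)
    then show ?case
      using x_init[OF s] y_init[OF s] by simp
  next
    case (Suc k)
    then have x_eq: "x k s = phi A B x0 (y k s)" "x (k + 1) s = phi A B x0 (y (k + 1) s)"
      and y: "y (k + 1) s \<in> carrier_vec m" "y k s \<in> carrier_vec m"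
      by auto
    have dim: "dim_row (S (k + 1) s) = m"
      by (rule iid_sketches_dim_row[OF S _ s]) simp
    have x_next: "x (k + 2) s = mSGD_step A B b \<omega> \<beta> (S (k + 1) s) (x (k + 1) s) (x k s)"
      using mSGD[OF s, of "k + 1"] by simp
    have y_next: "y (k + 2) s = mSDSA_step A B b x0 \<omega> \<beta> (S (k + 1) s) (y (k + 1) s) (y k s)"
      using mSDSA[OF s, of "k + 1"] by simp
    have "x (k + 2) s = phi A B x0 (y (k + 2) s)"
      unfolding x_next y_next x_eq by (rule phi_mSDSA_step[OF A B dim b x0 y, symmetric])
    moreover have "y (k + 2) s \<in> carrier_vec m"
      unfolding y_next mSDSA_step_eq[OF A B dim b x0 y(1)]
      by (rule carrier_vecI) (use carrier_vecD[OF y(2)] in simp)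
    ultimately show ?case
      using Suc by simp
  qed
  then show "\<forall>k. x k s = phi A B x0 (y k s)" by blast
qed

end
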